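(* For every positive integer $k$, let $\langle k\rangle$ denote the generalized pattern $k(k-1)\cdots21$ (no dashes). Then $$F_{\langle k\rangle}(x)=\sum_{j=0}^{k-1}\bigl(xF_{\langle k\rangle}(x)\bigr)^j.$$
   Context: A generalized pattern is a permutation of $\{1,\dots,k\}$ written as a word $\tau_1\cdots\tau_k$ in which each pair of adjacent letters may or may not be separated by a dash "-". A permutation $\pi=\pi_1\cdots\pi_n\in S_n$ contains $\tau$ if there are indices $i_1<\dots<i_k$ with $(\pi_{i_1},\dots,\pi_{i_k})$ order-isomorphic to $(\tau_1,\dots,\tau_k)$ and $i_{j+1}=i_j+1$ whenever $\tau_j,\tau_{j+1}$ are not separated by a dash; otherwise $\pi$ avoids $\tau$. Thus $k\cdots21$ (no dashes) requires $k$ consecutive decreasing entries, and $1\mbox{-}3\mbox{-}2$ is the classical pattern $132$. $F_\tau(x)=\sum_{n\geq0}f_\tau(n)x^n$, where $f_\tau(n)$ is the number of permutations in $S_n$ ($S_0$ = the empty permutation) avoiding both $1\mbox{-}3\mbox{-}2$ and $\tau$. *)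

theory Defs
  imports "HOL-Combinatorics.Multiset_Permutations" "HOL-Computational_Algebra.Formal_Power_Series"
begin

(* A generalized pattern is a word together with its set of dashes.  List positions count from 0:
   j is in the dash set iff a dash separates the letters at positions j and Suc j. *)
type_synonym gpattern = "nat list \<times> nat set"

definition is_gpattern :: "gpattern \<Rightarrow> bool" where
  "is_gpattern \<tau> \<longleftrightarrow>
     fst \<tau> \<in> permutations_of_set {1..length (fst \<tau>)} \<and> (\<forall>j\<in>snd \<tau>. Suc j < length (fst \<tau>))"

definition contains :: "nat list \<Rightarrow> gpattern \<Rightarrow> bool" where
  "contains \<pi> \<tau> \<longleftrightarrow>
     (let t = fst \<tau>; k = length t in
      \<exists>i. strict_mono_on {..<k} i \<and> (\<forall>a<k. i a < length \<pi>) \<and>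
          (\<forall>a<k. \<forall>b<k. \<pi> ! i a < \<pi> ! i b \<longleftrightarrow> t ! a < t ! b) \<and>
          (\<forall>j. Suc j < k \<and> j \<notin> snd \<tau> \<longrightarrow> i (Suc j) = i j + 1))"

definition avoids :: "nat list \<Rightarrow> gpattern \<Rightarrow> bool" where
  "avoids \<pi> \<tau> \<longleftrightarrow> \<not> contains \<pi> \<tau>"

definition pattern_1_3_2 :: gpattern where
  "pattern_1_3_2 = ([1, 3, 2], {0, 1})"

definition decreasing_pattern :: "nat \<Rightarrow> gpattern" where
  "decreasing_pattern k = (rev [1..<Suc k], {})"

definition f_count :: "gpattern \<Rightarrow> nat \<Rightarrow> nat" where
  "f_count \<tau> n =
     card {\<pi> \<in> permutations_of_set {1..n}. avoids \<pi> pattern_1_3_2 \<and> avoids \<pi> \<tau>}"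

definition F_gf :: "gpattern \<Rightarrow> int fps" where
  "F_gf \<tau> = Abs_fps (\<lambda>n. int (f_count \<tau> n))"

lemma is_gpattern_pattern_1_3_2: "is_gpattern pattern_1_3_2"
  by (auto simp: is_gpattern_def pattern_1_3_2_def permutations_of_set_def)

lemma is_gpattern_decreasing_pattern: "is_gpattern (decreasing_pattern k)"
  by (auto simp: is_gpattern_def decreasing_pattern_def permutations_of_set_def)

end

theory Submission
  imports Defs "HOL-Library.Sublist" "HOL-Library.Infinite_Set"
begin

text \<open>
  Write a nonempty 1-3-2-avoiding permutation as \<open>\<sigma> n \<tau>\<close> with \<open>n\<close> its maximum; then every letter
  of \<open>\<sigma>\<close> exceeds every letter of \<open>\<tau>\<close>. Let \<open>G m\<close> be the generating function of the permutations
  avoiding 1-3-2 and \<open>k\<dots>21\<close> whose initial decreasing run has length at most \<open>m\<close>. The initial run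
  of \<open>\<sigma> n \<tau>\<close> is that of \<open>\<sigma>\<close> if \<open>\<sigma>\<close> is nonempty, and otherwise \<open>n\<close> followed by that of \<open>\<tau>\<close>, so
  \<open>G (m + 1) = 1 + x G m + x G (k - 2) (G (m + 1) - 1)\<close> for \<open>m + 1 < k\<close>. As \<open>F = G (k - 1)\<close>, the
  case \<open>m = k - 2\<close> says \<open>F (1 - x G (k - 2)) = 1\<close>. Multiplying the general equation by \<open>F\<close> gives
  \<open>G (m + 1) = 1 + x F G m\<close>, hence \<open>G m\<close> is the sum of \<open>(x F) ^ j\<close> over \<open>j \<le> m\<close>.
\<close>

section \<open>Pattern avoidance by recursion on words\<close>

fun avoids_132 :: "'a::linorder list \<Rightarrow> bool" where
  "avoids_132 [] \<longleftrightarrow> True"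
| "avoids_132 (x # xs) \<longleftrightarrow> sorted_wrt (\<lambda>y z. \<not> (x < z \<and> z < y)) xs \<and> avoids_132 xs"

lemma avoids_132_iff_nth:
  "avoids_132 xs \<longleftrightarrow> (\<forall>c<length xs. \<forall>b<c. \<forall>a<b. \<not> (xs ! a < xs ! c \<and> xs ! c < xs ! b))"
  by (induction xs) (auto simp: All_less_Suc2 sorted_wrt_iff_nth_less)

lemma avoids_pattern_1_3_2_iff: "avoids xs pattern_1_3_2 \<longleftrightarrow> avoids_132 xs"
proof -
  have "contains xs pattern_1_3_2 \<longleftrightarrow>
      (\<exists>a b c. a < b \<and> b < c \<and> c < length xs \<and> xs ! a < xs ! c \<and> xs ! c < xs ! b)"
    (is "_ \<longleftrightarrow> ?occurrence")
  proof
    assume "contains xs pattern_1_3_2"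
    then obtain i where mono: "strict_mono_on {..<3::nat} i" and bound: "\<forall>a<3. i a < length xs"
      and iso: "\<forall>a<3. \<forall>b<3. xs ! i a < xs ! i b \<longleftrightarrow> [1, 3, 2::nat] ! a < [1, 3, 2] ! b"
      by (auto simp: contains_def pattern_1_3_2_def Let_def numeral_3_eq_3)
    have "i 0 < i 1" "i 1 < i 2" "i 2 < length xs"
      using mono bound by (auto simp: strict_mono_on_def)
    moreover have "xs ! i 0 < xs ! i 2" "xs ! i 2 < xs ! i 1"
      using iso by auto
    ultimately show ?occurrence by blast
  next
    assume ?occurrence
    then obtain a b c where "a < b" "b < c" "c < length xs" "xs ! a < xs ! c" "xs ! c < xs ! b"
      by blast
    then show "contains xs pattern_1_3_2"
      unfolding contains_def pattern_1_3_2_def Let_def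
      by (intro exI[of _ "\<lambda>j. [a, b, c] ! j"])
        (auto simp: strict_mono_on_def less_Suc_eq numeral_3_eq_3)
  qed
  then show ?thesis
    unfolding avoids_def avoids_132_iff_nth by (meson order.strict_trans)
qed

definition order_isomorphic :: "'a::linorder list \<Rightarrow> 'b::linorder list \<Rightarrow> bool" where
  "order_isomorphic xs ys \<longleftrightarrow>
     length xs = length ys \<and>
     (\<forall>a<length ys. \<forall>b<length ys. xs ! a < xs ! b \<longleftrightarrow> ys ! a < ys ! b)"

lemma contains_without_dashes_iff:
  "contains xs (t, {}) \<longleftrightarrow> (\<exists>ys. sublist ys xs \<and> order_isomorphic ys t)"
proof
  assume "contains xs (t, {})"
  then obtain i where bound: "\<And>a. a < length t \<Longrightarrow> i a < length xs"
    and iso: "\<And>a b. a < length t \<Longrightarrow> b < length t \<Longrightarrow> xs ! i a < xs ! i b \<longleftrightarrow> t ! a < t ! b"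
    and adjacent: "\<And>j. Suc j < length t \<Longrightarrow> i (Suc j) = Suc (i j)"
    by (auto simp: contains_def Let_def)
  define p where "p = i 0"
  have shift: "i a = p + a" if "a < length t" for a
    using that by (induction a) (simp_all add: adjacent p_def)
  let ?ys = "take (length t) (drop p xs)"
  have "t = [] \<or> p + length t \<le> length xs"
    using bound[of "length t - 1"] shift[of "length t - 1"] by (cases t) auto
  moreover have "xs ! (p + a) < xs ! (p + b) \<longleftrightarrow> t ! a < t ! b"
    if "a < length t" "b < length t" for a b
    using iso[OF that] shift that by simp
  ultimately have "order_isomorphic ?ys t"
    by (auto simp: order_isomorphic_def)
  moreover have "sublist ?ys xs"
    unfolding sublist_def by (metis append_take_drop_id)
  ultimately show "\<exists>ys. sublist ys xs \<and> order_isomorphic ys t" by blast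
next
  assume "\<exists>ys. sublist ys xs \<and> order_isomorphic ys t"
  then obtain ps ys ss where "xs = ps @ ys @ ss" "order_isomorphic ys t"
    by (auto simp: sublist_def)
  then show "contains xs (t, {})"
    unfolding contains_def Let_def
    by (intro exI[of _ "\<lambda>a. length ps + a"])
      (auto simp: order_isomorphic_def strict_mono_on_def nth_append)
qed

lemma order_isomorphic_decreasing_iff:
  assumes "sorted_wrt (>) ys"
  shows "order_isomorphic xs ys \<longleftrightarrow> length xs = length ys \<and> sorted_wrt (>) xs"
proof -
  have nth_less_iff: "zs ! a < zs ! b \<longleftrightarrow> b < a"
    if "sorted_wrt (>) zs" "a < length zs" "b < length zs" for a b and zs :: "'c::linorder list"
    using that sorted_wrt_nth_less[OF that(1), of a b] sorted_wrt_nth_less[OF that(1), of b a]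
    by (cases a b rule: linorder_cases) auto
  show ?thesis
    using assms by (auto simp: order_isomorphic_def nth_less_iff sorted_wrt_iff_nth_less[of _ xs])
qed

lemma contains_decreasing_pattern_iff:
  "contains xs (decreasing_pattern k) \<longleftrightarrow>
     (\<exists>ys. sublist ys xs \<and> length ys = k \<and> sorted_wrt (>) ys)"
proof -
  have "sorted_wrt (>) (rev [1..<Suc k])"
    by (simp add: sorted_wrt_rev del: upt_Suc)
  then show ?thesis
    by (simp add: decreasing_pattern_def contains_without_dashes_iff
        order_isomorphic_decreasing_iff del: upt_Suc)
qed

fun decreasing_run :: "'a::linorder list \<Rightarrow> nat" where
  "decreasing_run [] = 0"
| "decreasing_run [x] = 1"
| "decreasing_run (x # y # zs) = (if y < x then Suc (decreasing_run (y # zs)) else 1)"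

fun decreasing_runs_below :: "nat \<Rightarrow> 'a::linorder list \<Rightarrow> bool" where
  "decreasing_runs_below k [] \<longleftrightarrow> True"
| "decreasing_runs_below k (x # xs) \<longleftrightarrow> decreasing_run (x # xs) < k \<and> decreasing_runs_below k xs"

lemma decreasing_run_eq_0_iff: "decreasing_run xs = 0 \<longleftrightarrow> xs = []"
  by (cases xs rule: decreasing_run.cases) auto

lemma decreasing_run_less:
  "k \<ge> 1 \<Longrightarrow> decreasing_runs_below k xs \<Longrightarrow> decreasing_run xs < k"
  by (cases xs) auto

lemma le_decreasing_run_iff_take:
  "k \<le> decreasing_run xs \<longleftrightarrow> k \<le> length xs \<and> sorted_wrt (>) (take k xs)"
proof (induction xs arbitrary: k rule: decreasing_run.induct)
  case (3 x y zs)
  have sorted_Cons: "sorted_wrt (>) (x # y # take j zs) \<longleftrightarrow>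
      y < x \<and> sorted_wrt (>) (y # take j zs)" for j
    by auto
  consider "k = 0" | "k = 1" | j where "k = Suc (Suc j)"
    by (metis One_nat_def not0_implies_Suc)
  then show ?case
  proof cases
    case (3 j)
    then show ?thesis
      using "3.IH"[of "Suc j"] sorted_Cons[of j] by (auto simp del: sorted_wrt.simps)
  qed auto
qed (auto simp: le_Suc_eq)

lemma le_decreasing_run_iff_prefix:
  "k \<le> decreasing_run xs \<longleftrightarrow> (\<exists>ys. prefix ys xs \<and> length ys = k \<and> sorted_wrt (>) ys)"
  unfolding le_decreasing_run_iff_take
  by (auto elim!: prefixE intro!: exI[of _ "take k xs"] take_is_prefix)

lemma decreasing_runs_below_iff_sublist:
  assumes "k \<ge> 1"
  shows "decreasing_runs_below k xs \<longleftrightarrow>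
    \<not> (\<exists>ys. sublist ys xs \<and> length ys = k \<and> sorted_wrt (>) ys)"
proof (induction xs)
  case Nil
  then show ?case
    using assms by auto
next
  case (Cons x xs)
  then show ?case
    using le_decreasing_run_iff_prefix[of k "x # xs"]
    by (auto simp: sublist_Cons_right not_le[symmetric])
qed

lemma avoids_decreasing_pattern_iff:
  "k \<ge> 1 \<Longrightarrow> avoids xs (decreasing_pattern k) \<longleftrightarrow> decreasing_runs_below k xs"
  by (simp add: avoids_def contains_decreasing_pattern_iff decreasing_runs_below_iff_sublist)

section \<open>Invariance under order isomorphisms\<close>

lemma avoids_132_map:
  "strict_mono_on (set xs) f \<Longrightarrow> avoids_132 (map f xs) \<longleftrightarrow> avoids_132 xs"
  by (simp add: avoids_132_iff_nth strict_mono_on_less)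

lemma decreasing_run_map:
  "strict_mono_on (set xs) f \<Longrightarrow> decreasing_run (map f xs) = decreasing_run xs"
proof (induction xs rule: decreasing_run.induct)
  case (3 x y zs)
  have "strict_mono_on (set (y # zs)) f"
    using "3.prems" by (rule monotone_on_subset) auto
  moreover have "f y < f x \<longleftrightarrow> y < x"
    using "3.prems" by (simp add: strict_mono_on_less)
  ultimately show ?case
    using "3.IH" by simp
qed auto

lemma decreasing_runs_below_map:
  "strict_mono_on (set xs) f \<Longrightarrow> decreasing_runs_below k (map f xs) \<longleftrightarrow> decreasing_runs_below k xs"
proof (induction xs)
  case (Cons x xs)
  have "strict_mono_on (set xs) f"
    using Cons.prems by (rule monotone_on_subset) auto
  then show ?case
    using Cons.IH decreasing_run_map[OF Cons.prems] by simp
qed simp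

definition run_bounded_perms :: "nat \<Rightarrow> nat \<Rightarrow> 'a::linorder set \<Rightarrow> 'a list set" where
  "run_bounded_perms k m A =
     {\<pi> \<in> permutations_of_set A.
        avoids_132 \<pi> \<and> decreasing_runs_below k \<pi> \<and> decreasing_run \<pi> \<le> m}"

lemma finite_run_bounded_perms: "finite (run_bounded_perms k m A)"
  by (simp add: run_bounded_perms_def)

lemma run_bounded_perms_empty: "run_bounded_perms k m {} = {[]}"
  by (auto simp: run_bounded_perms_def)

lemma run_bounded_perms_0: "run_bounded_perms k 0 A = (if A = {} then {[]} else {})"
  by (auto simp: run_bounded_perms_def decreasing_run_eq_0_iff dest: permutations_of_setD(1))

lemma run_bounded_perms_subset: "run_bounded_perms k m A \<subseteq> permutations_of_set A"
  by (auto simp: run_bounded_perms_def)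

lemma run_bounded_perms_image:
  assumes "strict_mono_on A f"
  shows "run_bounded_perms k m (f ` A) = map f ` run_bounded_perms k m A"
  using assms
  by (auto simp: run_bounded_perms_def permutations_of_set_image_inj strict_mono_on_imp_inj_on
      avoids_132_map decreasing_run_map decreasing_runs_below_map permutations_of_setD(1))

lemma card_run_bounded_perms:
  fixes A :: "'a::wellorder set"
  assumes "finite A"
  shows "card (run_bounded_perms k m A) = card (run_bounded_perms k m {..<card A})"
proof -
  obtain h where bij: "bij_betw h {..<card A} A" and mono: "strict_mono_on {..<card A} h"
    using ex_bij_betw_strict_mono_card[OF assms] .
  have "run_bounded_perms k m A = map h ` run_bounded_perms k m {..<card A}"
    using run_bounded_perms_image[OF mono] bij by (simp add: bij_betw_imp_surj_on)
  moreover have "inj_on (map h) (run_bounded_perms k m {..<card A})"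
  proof (rule inj_on_subset)
    show "inj_on (map h) (lists {..<card A})"
      using bij by (simp add: bij_betw_imp_inj_on inj_on_map_lists)
    show "run_bounded_perms k m {..<card A} \<subseteq> lists {..<card A}"
      by (auto simp: run_bounded_perms_def dest: permutations_of_setD)
  qed
  ultimately show ?thesis
    by (simp add: card_image)
qed

section \<open>Splitting at the maximum\<close>

lemma avoids_132_append_max:
  assumes "\<forall>x\<in>set s. x < n" "\<forall>x\<in>set t. x < n"
  shows "avoids_132 (s @ n # t) \<longleftrightarrow>
           avoids_132 s \<and> avoids_132 t \<and> (\<forall>x\<in>set s. \<forall>y\<in>set t. y \<le> x)"
  using assms
proof (induction s)
  case Nil
  then have "sorted_wrt (\<lambda>y z. \<not> (n < z \<and> z < y)) t"
    by (auto simp: sorted_wrt_iff_nth_less dest!: nth_mem)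
  then show ?case by simp
next
  case (Cons x s)
  have "sorted_wrt (\<lambda>y z. \<not> (x < z \<and> z < y)) t" if "\<forall>y\<in>set t. y \<le> x"
    using that by (auto simp: sorted_wrt_iff_nth_less not_less)
  then have "sorted_wrt (\<lambda>y z. \<not> (x < z \<and> z < y)) (s @ n # t) \<longleftrightarrow>
      sorted_wrt (\<lambda>y z. \<not> (x < z \<and> z < y)) s \<and> (\<forall>y\<in>set t. y \<le> x)"
    using Cons.prems by (fastforce simp: sorted_wrt_append not_less)
  then show ?case
    using Cons by auto
qed

lemma decreasing_run_Cons_max:
  "\<forall>x\<in>set t. x < n \<Longrightarrow> decreasing_run (n # t) = Suc (decreasing_run t)"
  by (cases t) auto

lemma decreasing_run_append_max:
  "s \<noteq> [] \<Longrightarrow> \<forall>x\<in>set s. x < n \<Longrightarrow> decreasing_run (s @ n # t) = decreasing_run s"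
  by (induction s rule: decreasing_run.induct) auto

lemma decreasing_runs_below_append_max:
  assumes "\<forall>x\<in>set s. x < n"
  shows "decreasing_runs_below k (s @ n # t) \<longleftrightarrow>
           decreasing_runs_below k s \<and> decreasing_runs_below k (n # t)"
  using assms
proof (induction s)
  case (Cons x s)
  have "decreasing_run (x # s @ n # t) = decreasing_run (x # s)"
    using decreasing_run_append_max[of "x # s" n t] Cons.prems by simp
  then show ?case
    using Cons by auto
qed simp

lemma append_max_mem_run_bounded_perms_iff:
  assumes perms: "s \<in> permutations_of_set A" "t \<in> permutations_of_set B"
    and "Suc m < k" and max: "\<forall>x\<in>A \<union> B. x < n" and less: "\<forall>x\<in>A. \<forall>y\<in>B. y < x"
  shows "s @ n # t \<in> run_bounded_perms k (Suc m) (insert n (A \<union> B)) \<longleftrightarrow>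
     s \<in> run_bounded_perms k (Suc m) A \<and>
     t \<in> run_bounded_perms k (if s = [] then m else k - 2) B"
proof -
  have sets: "set s = A" "set t = B" and distinct: "distinct s" "distinct t"
    using perms by (auto dest: permutations_of_setD)
  have max_s: "\<forall>x\<in>set s. x < n" and max_t: "\<forall>x\<in>set t. x < n"
    using max sets by auto
  have perm: "s @ n # t \<in> permutations_of_set (insert n (A \<union> B))"
    using sets distinct max less by (intro permutations_of_setI) auto
  have avoids: "avoids_132 (s @ n # t) \<longleftrightarrow> avoids_132 s \<and> avoids_132 t"
    using less by (simp add: avoids_132_append_max[OF max_s max_t] sets order.strict_implies_order)
  have runs_below: "decreasing_runs_below k (s @ n # t) \<longleftrightarrow>
      decreasing_runs_below k s \<and> decreasing_run t \<le> k - 2 \<and> decreasing_runs_below k t"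
    using \<open>Suc m < k\<close>
    by (auto simp: decreasing_runs_below_append_max[OF max_s] decreasing_run_Cons_max[OF max_t])
  have initial_run: "decreasing_run (s @ n # t) =
      (if s = [] then Suc (decreasing_run t) else decreasing_run s)"
    by (simp add: decreasing_run_append_max[OF _ max_s] decreasing_run_Cons_max[OF max_t])
  show ?thesis
    using perm perms \<open>Suc m < k\<close>
    by (auto simp: run_bounded_perms_def avoids runs_below initial_run)
qed

lemma lessThan_split_at:
  fixes n :: "'a::wellorder"
  assumes "A \<union> B = {..<n}" "\<forall>x\<in>A. \<forall>y\<in>B. y < x"
  obtains j where "j \<le> n" "A = {j..<n}" "B = {..<j}"
proof
  define j where "j = (LEAST j. j \<in> insert n A)"
  have j: "j \<in> insert n A" and least: "\<And>x. x \<in> insert n A \<Longrightarrow> j \<le> x"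
    unfolding j_def by (rule LeastI, rule insertI1) (rule Least_le)
  show "j \<le> n"
    using least by simp
  show B: "B = {..<j}"
  proof (intro equalityI subsetI)
    show "x \<in> {..<j}" if "x \<in> B" for x
      using that j assms by auto
    show "x \<in> B" if "x \<in> {..<j}" for x
    proof -
      have "x \<in> A \<union> B"
        using that \<open>j \<le> n\<close> by (simp add: assms(1))
      moreover have "x \<notin> A"
        using that least[of x] by auto
      ultimately show ?thesis by simp
    qed
  qed
  show "A = {j..<n}"
    using assms least B by fastforce
qed

lemma avoids_132_permutation_split:
  fixes n :: nat
  assumes perm: "\<pi> \<in> permutations_of_set {..<Suc n}" and avoids: "avoids_132 \<pi>"
  obtains j s t where "j \<le> n" "\<pi> = s @ n # t"
    "s \<in> permutations_of_set {j..<n}" "t \<in> permutations_of_set {..<j}"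
proof -
  have "n \<in> set \<pi>"
    using perm by (simp add: permutations_of_setD(1))
  then obtain s t where \<pi>: "\<pi> = s @ n # t"
    by (meson split_list)
  then have distinct: "distinct (s @ n # t)" and set: "set (s @ n # t) = {..<Suc n}"
    using perm permutations_of_setD by blast+
  have "set s \<union> set t = set (s @ n # t) - {n}"
    using distinct by auto
  also have "\<dots> = {..<n}"
    unfolding set by auto
  finally have union: "set s \<union> set t = {..<n}" .
  then have "\<forall>x\<in>set s. x < n" "\<forall>x\<in>set t. x < n"
    by blast+
  then have "\<forall>x\<in>set s. \<forall>y\<in>set t. y \<le> x"
    using avoids \<pi> by (simp add: avoids_132_append_max)
  then have "\<forall>x\<in>set s. \<forall>y\<in>set t. y < x"
    using distinct by (auto simp: order.strict_iff_order)
  with union obtain j where "j \<le> n" "set s = {j..<n}" "set t = {..<j}"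
    by (rule lessThan_split_at)
  then show thesis
    using distinct by (intro that[OF _ \<pi>] permutations_of_setI) auto
qed

section \<open>The generating functions of run-bounded permutations\<close>

lemma run_bounded_perms_lessThan_Suc:
  fixes n :: nat
  assumes "Suc m < k"
  shows "run_bounded_perms k (Suc m) {..<Suc n} =
     (\<lambda>(j, s, t). s @ n # t) `
       (SIGMA j:{..n}. run_bounded_perms k (Suc m) {j..<n} \<times>
          run_bounded_perms k (if j = n then m else k - 2) {..<j})"
    (is "?perms = ?glue ` ?parts")
proof -
  have mem_iff: "s @ n # t \<in> ?perms \<longleftrightarrow> (j, s, t) \<in> ?parts"
    if "j \<le> n" "s \<in> permutations_of_set {j..<n}" "t \<in> permutations_of_set {..<j}" for j s t
  proof -
    have union: "{..<Suc n} = insert n ({j..<n} \<union> {..<j})"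
      using \<open>j \<le> n\<close> by auto
    have "s = [] \<longleftrightarrow> j = n"
      using that(1) permutations_of_setD(1)[OF that(2)] by auto
    moreover have "\<forall>x\<in>{j..<n} \<union> {..<j}. x < n" "\<forall>x\<in>{j..<n}. \<forall>y\<in>{..<j}. y < x"
      using \<open>j \<le> n\<close> by auto
    ultimately show ?thesis
      using append_max_mem_run_bounded_perms_iff[OF that(2,3) assms] \<open>j \<le> n\<close>
      unfolding union by simp
  qed
  show ?thesis
  proof (intro equalityI subsetI)
    fix \<pi> assume \<pi>: "\<pi> \<in> ?perms"
    then have "\<pi> \<in> permutations_of_set {..<Suc n}" "avoids_132 \<pi>"
      by (simp_all add: run_bounded_perms_def)
    then obtain j s t where "j \<le> n" "\<pi> = s @ n # t"
      "s \<in> permutations_of_set {j..<n}" "t \<in> permutations_of_set {..<j}"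
      by (rule avoids_132_permutation_split)
    moreover from this have "(j, s, t) \<in> ?parts"
      using mem_iff \<pi> by simp
    ultimately show "\<pi> \<in> ?glue ` ?parts"
      by (intro image_eqI[of _ _ "(j, s, t)"]) simp_all
  next
    fix \<pi> assume "\<pi> \<in> ?glue ` ?parts"
    then obtain p where "p \<in> ?parts" "\<pi> = ?glue p"
      by (rule imageE)
    moreover obtain j s t where "p = (j, s, t)"
      by (cases p)
    ultimately have parts: "(j, s, t) \<in> ?parts" and "\<pi> = s @ n # t"
      by simp_all
    moreover have "j \<le> n" "s \<in> permutations_of_set {j..<n}" "t \<in> permutations_of_set {..<j}"
      using parts by (simp_all add: run_bounded_perms_def)
    ultimately show "\<pi> \<in> ?perms"
      using mem_iff by simp
  qed
qed

lemma inj_on_append_max: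
  fixes n :: nat
  shows "inj_on (\<lambda>(j, s, t). s @ n # t)
     (SIGMA j:{..n}. permutations_of_set {j..<n} \<times> permutations_of_set {..<j})"
proof (rule inj_onI, clarsimp)
  fix j s t j' s' t'
  assume "j \<le> n"
    and perms: "s \<in> permutations_of_set {j..<n}" "t \<in> permutations_of_set {..<j}"
      "t' \<in> permutations_of_set {..<j'}"
    and eq: "s @ n # t = s' @ n # t'"
  have "n \<notin> set s" "n \<notin> set t"
    using \<open>j \<le> n\<close> perms by (auto dest: permutations_of_setD)
  then have "s = s'" "t = t'"
    using eq by (simp_all add: append_Cons_eq_iff)
  moreover have "{..<j} = {..<j'}"
    using perms \<open>t = t'\<close> by (metis permutations_of_setD(1))
  ultimately show "j = j' \<and> s = s' \<and> t = t'"
    by simp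
qed

lemma card_run_bounded_perms_Suc:
  fixes n :: nat
  assumes "Suc m < k"
  shows "card (run_bounded_perms k (Suc m) {..<Suc n}) =
     (\<Sum>j\<le>n. card (run_bounded_perms k (if j = n then m else k - 2) {..<j}) *
        card (run_bounded_perms k (Suc m) {..<n - j}))"
proof -
  let ?parts = "SIGMA j:{..n}. run_bounded_perms k (Suc m) {j..<n} \<times>
    run_bounded_perms k (if j = n then m else k - 2) {..<j}"
  have "inj_on (\<lambda>(j, s, t). s @ n # t) ?parts"
    by (rule inj_on_subset[OF inj_on_append_max])
      (intro Sigma_mono order.refl Sigma_mono run_bounded_perms_subset)
  then have "card (run_bounded_perms k (Suc m) {..<Suc n}) = card ?parts"
    unfolding run_bounded_perms_lessThan_Suc[OF assms] by (rule card_image)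
  also have "\<dots> = (\<Sum>j\<le>n. card (run_bounded_perms k (Suc m) {j..<n}) *
      card (run_bounded_perms k (if j = n then m else k - 2) {..<j}))"
    by (simp add: finite_run_bounded_perms card_cartesian_product)
  finally show ?thesis
    using card_run_bounded_perms[of "{_..<n}"] by (simp add: mult.commute)
qed

definition run_bounded_gf :: "nat \<Rightarrow> nat \<Rightarrow> int fps" where
  "run_bounded_gf k m = Abs_fps (\<lambda>n. int (card (run_bounded_perms k m {..<n})))"

lemma F_gf_decreasing_pattern:
  assumes "k \<ge> 1"
  shows "F_gf (decreasing_pattern k) = run_bounded_gf k (k - 1)"
proof -
  have "decreasing_runs_below k \<pi> \<longleftrightarrow> decreasing_runs_below k \<pi> \<and> decreasing_run \<pi> \<le> k - 1"
    for \<pi> :: "nat list"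
    using decreasing_run_less[OF assms, of \<pi>] by auto
  then have "f_count (decreasing_pattern k) n = card (run_bounded_perms k (k - 1) {1..n})" for n
    unfolding f_count_def run_bounded_perms_def avoids_pattern_1_3_2_iff
      avoids_decreasing_pattern_iff[OF assms] by metis
  moreover have "card (run_bounded_perms k (k - 1) {1..n}) =
      card (run_bounded_perms k (k - 1) {..<n})" for n :: nat
    by (subst card_run_bounded_perms) simp_all
  ultimately show ?thesis
    by (simp add: F_gf_def run_bounded_gf_def)
qed

lemma run_bounded_gf_0: "run_bounded_gf k 0 = 1"
  by (rule fps_ext) (simp add: run_bounded_gf_def run_bounded_perms_0 lessThan_empty_iff)

lemma run_bounded_gf_rec:
  assumes "Suc m < k"
  shows "run_bounded_gf k (Suc m) =
     1 + fps_X * run_bounded_gf k m +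
     fps_X * (run_bounded_gf k (k - 2) * (run_bounded_gf k (Suc m) - 1))"
    (is "?G (Suc m) = ?rhs")
proof (rule fps_ext)
  fix N
  let ?count = "\<lambda>m n. int (card (run_bounded_perms k m {..<n}))"
  show "fps_nth (?G (Suc m)) N = fps_nth ?rhs N"
  proof (cases N)
    case 0
    then show ?thesis
      by (simp add: run_bounded_gf_def run_bounded_perms_empty)
  next
    case (Suc n)
    have "fps_nth (?G (k - 2) * (?G (Suc m) - 1)) n =
        (\<Sum>j\<le>n. fps_nth (?G (k - 2)) j * fps_nth (?G (Suc m) - 1) (n - j))"
      by (simp add: fps_mult_nth atLeast0AtMost)
    also have "\<dots> = (\<Sum>j<n. ?count (k - 2) j * ?count (Suc m) (n - j))"
      by (simp add: run_bounded_gf_def run_bounded_perms_empty lessThan_Suc_atMost[symmetric])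
    finally have "fps_nth ?rhs N =
        ?count m n + (\<Sum>j<n. ?count (k - 2) j * ?count (Suc m) (n - j))"
      by (simp add: Suc run_bounded_gf_def)
    also have "\<dots> = ?count (Suc m) (Suc n)"
      unfolding card_run_bounded_perms_Suc[OF assms]
      by (simp add: run_bounded_perms_empty lessThan_Suc_atMost[symmetric])
    finally show ?thesis
      by (simp add: Suc run_bounded_gf_def)
  qed
qed

lemma run_bounded_gf_Suc:
  assumes "Suc m < k"
  shows "run_bounded_gf k (Suc m) = 1 + fps_X * run_bounded_gf k (k - 1) * run_bounded_gf k m"
proof -
  let ?G = "run_bounded_gf k"
  have "Suc (k - 2) = k - 1"
    using assms by simp
  then have "?G (k - 1) = 1 + fps_X * ?G (k - 2) + fps_X * (?G (k - 2) * (?G (k - 1) - 1))"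
    using run_bounded_gf_rec[of "k - 2" k] assms by simp
  then show ?thesis
    using run_bounded_gf_rec[OF assms] by algebra
qed

lemma run_bounded_gf_eq_sum:
  "m < k \<Longrightarrow> run_bounded_gf k m = (\<Sum>j=0..m. (fps_X * run_bounded_gf k (k - 1)) ^ j)"
proof (induction m)
  case 0
  then show ?case by (simp add: run_bounded_gf_0)
next
  case (Suc m)
  let ?F = "run_bounded_gf k (k - 1)"
  have "run_bounded_gf k (Suc m) = 1 + (\<Sum>j=0..m. (fps_X * ?F) ^ Suc j)"
    using Suc by (simp add: run_bounded_gf_Suc sum_distrib_left)
  also have "\<dots> = (\<Sum>j=0..Suc m. (fps_X * ?F) ^ j)"
    by (subst sum.atLeast0_atMost_Suc_shift) simp
  finally show ?case .
qed

theorem theorem2p12: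
  fixes k :: nat
  assumes "k \<ge> 1"
  shows "F_gf (decreasing_pattern k) =
           (\<Sum>j=0..k-1. (fps_X * F_gf (decreasing_pattern k)) ^ j)"
proof -
  have "run_bounded_gf k (k - 1) = (\<Sum>j=0..k-1. (fps_X * run_bounded_gf k (k - 1)) ^ j)"
    using assms by (intro run_bounded_gf_eq_sum) simp
  then show ?thesis
    unfolding F_gf_decreasing_pattern[OF assms] .
qed

end
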